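(* Consider a parent node with the corresponding function $G_p(z,y)$ defined on the interval $[a,b]$, with its associated functions $g_l,g_r$ (as given in the context), and let $\zeta$ be a point separating the two children's $z$-locations. Then there exists a number $\tilde\gamma$, which depends on $\zeta$, such that: \begin{itemize} \item For the left child, the new function $G_l(z,y)=G_p(z,y)-\tilde\gamma^2\cdot g_l(z)\cdot g_l(y)$ is the Green's function of the ODE problem $u_1(z)-u_1''(z)=f(z)$, $z\in[a,\zeta]$, with the same boundary condition as the parent at $z=a$, and $u_1(\zeta)=0$. The function $G_l(z,y)$ is positive definite. \item For the right child, the new function $G_r(z,y)=G_p(z,y)-\frac{1}{\tilde\gamma^2}\cdot g_r(z)\cdot g_r(y)$ is the Green's function of the ODE problem $u_2(z)-u_2''(z)=f(z)$, $z\in[\zeta,b]$, with $u_2(\zeta)=0$ and the same boundary condition as the parent at $z=b$. The function $G_r(z,y)$ is positive definite. \item The two child ODE problem solutions $u_1(z)$ and $u_2(z)$ can be derived by subtracting a single layer potential defined at $z=\zeta$ from the parent's solution $u(z)$, so that $u_1(z)$ and $u_2(z)$ satisfy the zero interface condition at $z=\zeta$. The other boundary condition for each child ODE problem is the same as its parent's boundary condition. \end{itemize}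
   Context: Ordered locations in $[0,1]$ are divided recursively: each parent node has an interval $[a,b]\subseteq[0,1]$ containing its $z$-locations, and these are split into two ordered subsets of equal size, belonging to the left child (interval $[a,\zeta]$) and the right child (interval $[\zeta,b]$). The root node has interval $[0,1]$. Parent problem on $[a,b]$: $u(z)-u''(z)=f(z)$ for $z\in[a,b]$. The boundary condition at $z=a$ is $u(0)=u'(0)$ if $a=0$ and $u(a)=0$ if $a>0$. The boundary condition at $z=b$ is $u(1)=-u'(1)$ if $b=1$ and $u(b)=0$ if $b<1$. The parent's solution is $u(z)=\int_a^bG_p(z,y)f(y)\,dy$. Parent function: $G_p(z,y)=coef\cdot g_r(z)\,g_l(y)$ for $y\le z$ and $G_p(z,y)=coef\cdot g_l(z)\,g_r(y)$ for $y>z$, where \begin{itemize} \item root node ($a=0$, $b=1$): $g_l(z)=e^{z-1}$, $g_r(z)=e^{1-z}$, $coef=\frac12$; \item left boundary node ($a=0$, $b<1$): $g_l(z)=e^{z-b}$, $g_r(z)=\sinh(b-z)$, $coef=1$; \item right boundary node ($a>0$, $b=1$): $g_l(z)=\sinh(z-a)$, $g_r(z)=e^{a-z}$, $coef=1$; \item interior node ($a>0$, $b<1$): $g_l(z)=\sinh(z-a)$, $g_r(z)=\sinh(b-z)$, $coef=\frac{2e^{a+b}}{e^{2b}-e^{2a}}$. \end{itemize} A function $K(z,y)$ is the Green's function of a two-point boundary value problem on an interval $I$ with right-hand side $f$ if $v(z)=\int_I K(z,y)f(y)\,dy$ satisfies the ODE and the boundary conditions. Here $G_l$ is considered on $[a,\zeta]\times[a,\zeta]$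 and $G_r$ on $[\zeta,b]\times[\zeta,b]$. A two-variable function $K(z,y)$ on $I\times I$ is positive definite if $\int_I f(z)\left(\int_I K(z,y)f(y)\,dy\right)dz>0$ for every $f\neq0$. A single layer potential defined at $z=\zeta$ is a function $z\mapsto\sigma G_p(z,\zeta)$ with $\sigma$ a constant.
   Formalization: The subtracted terms carry the extra factor coef: coef·γ̃²·g_l(z)g_l(y) and coef·(1/γ̃²)·g_r(z)g_r(y); as printed, the two zero conditions at ζ force coef² = 1, which fails e.g. at the root (coef = 1/2). Where coef = 1 the statement is unchanged. *)

theory Defs
  imports "HOL-Analysis.Analysis"
begin

text \<open>
  A node is given by the end points \<open>a < b\<close> of its interval, with \<open>0 \<le> a\<close> and \<open>b \<le> 1\<close>.
  The four cases below are root, left boundary, right boundary and interior node.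
\<close>

definition gl :: "real \<Rightarrow> real \<Rightarrow> real \<Rightarrow> real" where
  "gl a b z =
     (if a = 0 \<and> b = 1 then exp (z - 1)
      else if a = 0 then exp (z - b)
      else if b = 1 then sinh (z - a)
      else sinh (z - a))"

definition gr :: "real \<Rightarrow> real \<Rightarrow> real \<Rightarrow> real" where
  "gr a b z =
     (if a = 0 \<and> b = 1 then exp (1 - z)
      else if a = 0 then sinh (b - z)
      else if b = 1 then exp (a - z)
      else sinh (b - z))"

definition coef :: "real \<Rightarrow> real \<Rightarrow> real" where
  "coef a b =
     (if a = 0 \<and> b = 1 then 1 / 2
      else if a = 0 then 1
      else if b = 1 then 1
      else 2 * exp (a + b) / (exp (2 * b) - exp (2 * a)))"

definition Gp :: "real \<Rightarrow> real \<Rightarrow> real \<Rightarrow> real \<Rightarrow> real" where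
  "Gp a b z y =
     (if y \<le> z then coef a b * gr a b z * gl a b y
      else coef a b * gl a b z * gr a b y)"

text \<open>
  The kernels of the left and right child. The rank-one corrections carry the factor \<open>coef a b\<close>,
  as the two branches of \<open>Gp\<close> do: \<open>Gl\<close> vanishes for \<open>z = \<zeta>\<close> iff
  \<open>\<gamma>\<^sup>2 = gr a b \<zeta> / gl a b \<zeta>\<close>, and this is also the condition for \<open>Gr\<close>. Without the factor
  the two conditions are compatible only if \<open>coef a b = 1\<close>.
\<close>

definition Gl :: "real \<Rightarrow> real \<Rightarrow> real \<Rightarrow> real \<Rightarrow> real \<Rightarrow> real" where
  "Gl a b \<gamma> z y = Gp a b z y - coef a b * \<gamma>\<^sup>2 * gl a b z * gl a b y"

definition Gr :: "real \<Rightarrow> real \<Rightarrow> real \<Rightarrow> real \<Rightarrow> real \<Rightarrow> real" where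
  "Gr a b \<gamma> z y = Gp a b z y - coef a b * (1 / \<gamma>\<^sup>2) * gr a b z * gr a b y"

text \<open>
  A boundary condition is a predicate on a function and its first derivative.
\<close>

type_synonym bc = "(real \<Rightarrow> real) \<Rightarrow> (real \<Rightarrow> real) \<Rightarrow> bool"

definition parent_bc_left :: "real \<Rightarrow> bc" where
  "parent_bc_left a u u' \<longleftrightarrow> (if a = 0 then u 0 = u' 0 else u a = 0)"

definition parent_bc_right :: "real \<Rightarrow> bc" where
  "parent_bc_right b u u' \<longleftrightarrow> (if b = 1 then u 1 = - u' 1 else u b = 0)"

definition zero_bc :: "real \<Rightarrow> bc" where
  "zero_bc c u u' \<longleftrightarrow> u c = 0"

text \<open>
  Classical solutions of \<open>u - u'' = f\<close> on the closed interval; derivatives at the end points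
  are one-sided.
\<close>

definition solves_bvp ::
    "real \<Rightarrow> real \<Rightarrow> bc \<Rightarrow> bc \<Rightarrow> (real \<Rightarrow> real) \<Rightarrow> (real \<Rightarrow> real) \<Rightarrow> bool" where
  "solves_bvp lo hi BL BR f u \<longleftrightarrow>
     (\<exists>u' u''.
        (\<forall>z\<in>{lo..hi}. (u has_real_derivative u' z) (at z within {lo..hi})) \<and>
        (\<forall>z\<in>{lo..hi}. (u' has_real_derivative u'' z) (at z within {lo..hi})) \<and>
        (\<forall>z\<in>{lo..hi}. u z - u'' z = f z) \<and>
        BL u u' \<and> BR u u')"

definition greens_function ::
    "real \<Rightarrow> real \<Rightarrow> bc \<Rightarrow> bc \<Rightarrow> (real \<Rightarrow> real \<Rightarrow> real) \<Rightarrow> bool" where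
  "greens_function lo hi BL BR K \<longleftrightarrow>
     (\<forall>f. continuous_on {lo..hi} f \<longrightarrow>
        solves_bvp lo hi BL BR f (\<lambda>z. integral {lo..hi} (\<lambda>y. K z y * f y)))"

text \<open>
  The test functions are the square integrable ones, and \<open>f \<noteq> 0\<close> is read in that space:
  \<open>f\<close> does not vanish almost everywhere.
\<close>

definition positive_definite_on :: "real set \<Rightarrow> (real \<Rightarrow> real \<Rightarrow> real) \<Rightarrow> bool" where
  "positive_definite_on I K \<longleftrightarrow>
     (\<forall>f. f \<in> borel_measurable (lebesgue_on I) \<longrightarrow>
          (\<lambda>z. (f z)\<^sup>2) integrable_on I \<longrightarrow>
          \<not> negligible {z \<in> I. f z \<noteq> 0} \<longrightarrow>
          integral I (\<lambda>z. f z * integral I (\<lambda>y. K z y * f y)) > 0)"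

text \<open>
  The rest of this theory shows that \<open>Gp\<close> is the Green's function of the parent problem; in
  particular the parent problem is solvable for every continuous right-hand side.
\<close>

lemma green_core:
  fixes p p' q q' f :: "real \<Rightarrow> real"
  assumes lt: "lo < hi"
    and p: "\<And>z. (p has_real_derivative p' z) (at z)" "\<And>z. (p' has_real_derivative p z) (at z)"
    and q: "\<And>z. (q has_real_derivative q' z) (at z)" "\<And>z. (q' has_real_derivative q z) (at z)"
    and w: "\<And>z. c * (p' z * q z - p z * q' z) = 1"
    and K: "\<And>z y. \<lbrakk>z \<in> {lo..hi}; y \<in> {lo..hi}\<rbrakk> \<Longrightarrow>
              K z y = (if y \<le> z then c * q z * p y else c * p z * q y)"
    and f: "continuous_on {lo..hi} f"
  defines "v \<equiv> \<lambda>z. integral {lo..hi} (\<lambda>y. K z y * f y)"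
  shows "\<exists>A B v'. (\<forall>z\<in>{lo..hi}. (v has_real_derivative v' z) (at z within {lo..hi})) \<and>
     (\<forall>z\<in>{lo..hi}. (v' has_real_derivative v z - f z) (at z within {lo..hi})) \<and>
     v lo = A * p lo \<and> v' lo = A * p' lo \<and> v hi = B * q hi \<and> v' hi = B * q' hi"
proof -
  have cp: "continuous_on S p" and cq: "continuous_on S q" for S
    using p(1) q(1) by (auto intro!: continuous_at_imp_continuous_on DERIV_isCont)
  define F where "F z = integral {lo..z} (\<lambda>y. p y * f y)" for z
  define G where "G z = integral {lo..z} (\<lambda>y. q y * f y)" for z
  have cpf: "continuous_on {lo..hi} (\<lambda>y. p y * f y)" and cqf: "continuous_on {lo..hi} (\<lambda>y. q y * f y)"
    using cp cq f by (auto intro: continuous_on_mult)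
  have dF: "(F has_real_derivative p z * f z) (at z within {lo..hi})" if "z \<in> {lo..hi}" for z
    unfolding F_def using integral_has_real_derivative[OF cpf that] .
  have dG: "(G has_real_derivative q z * f z) (at z within {lo..hi})" if "z \<in> {lo..hi}" for z
    unfolding G_def using integral_has_real_derivative[OF cqf that] .
  define V where "V z = c * (q z * F z + p z * (G hi - G z))" for z
  define V' where "V' z = c * (q' z * F z + p' z * (G hi - G z))" for z
  have vV: "v z = V z" if z: "z \<in> {lo..hi}" for z
  proof -
    have i1: "((\<lambda>y. K z y * f y) has_integral c * q z * F z) {lo..z}"
    proof (rule has_integral_eq)
      show "((\<lambda>y. (c * q z) * (p y * f y)) has_integral c * q z * F z) {lo..z}"
        unfolding F_def using z
        by (intro has_integral_mult_right integrable_integral integrable_continuous_real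
            continuous_on_subset[OF cpf]) auto
    qed (use z K in auto)
    have GG: "G z + integral {z..hi} (\<lambda>y. q y * f y) = G hi"
      unfolding G_def using z
      by (intro Henstock_Kurzweil_Integration.integral_combine integrable_continuous_real cqf) auto
    have i2: "((\<lambda>y. K z y * f y) has_integral c * p z * (G hi - G z)) {z..hi}"
    proof (rule has_integral_eq)
      have "integral {z..hi} (\<lambda>y. q y * f y) = G hi - G z" using GG by simp
      then show "((\<lambda>y. (c * p z) * (q y * f y)) has_integral c * p z * (G hi - G z)) {z..hi}"
        using z by (intro has_integral_mult_right)
          (metis atLeastAtMost_iff atLeastatMost_subset_iff continuous_on_subset cqf
             integrable_continuous_real integrable_integral order_refl)
    qed (use z K in auto)
    from has_integral_combine[OF _ _ i1 i2] z show ?thesis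
      unfolding v_def V_def by (auto simp: algebra_simps dest!: integral_unique)
  qed
  have dV: "(V has_real_derivative V' z) (at z within {lo..hi})" if "z \<in> {lo..hi}" for z
    unfolding V_def
    apply (rule derivative_eq_intros dF[OF that] dG[OF that]
        has_field_derivative_at_within[OF p(1)] has_field_derivative_at_within[OF q(1)] refl)+
    by (simp add: V'_def algebra_simps)
  have dV': "(V' has_real_derivative V z - f z) (at z within {lo..hi})" if "z \<in> {lo..hi}" for z
    unfolding V'_def
    apply (rule derivative_eq_intros dF[OF that] dG[OF that]
        has_field_derivative_at_within[OF p(2)] has_field_derivative_at_within[OF q(2)] refl)+
    using arg_cong[OF w[of z], of "\<lambda>t. t * f z"] by (simp add: V_def algebra_simps)
  have "F lo = 0" "G lo = 0" by (simp_all add: F_def G_def)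
  then have bc: "V lo = (c * G hi) * p lo" "V' lo = (c * G hi) * p' lo"
    "V hi = (c * F hi) * q hi" "V' hi = (c * F hi) * q' hi"
    by (simp_all add: V_def V'_def algebra_simps)
  show ?thesis
    apply (rule exI[of _ "c * G hi"], rule exI[of _ "c * F hi"], rule exI[of _ V'])
    using bc dV dV' vV lt
    by (auto intro!: has_field_derivative_transform_within[OF dV zero_less_one])
qed

lemma solves_bvpI:
  assumes "\<exists>A B v'. (\<forall>z\<in>{lo..hi}. (v has_real_derivative v' z) (at z within {lo..hi})) \<and>
     (\<forall>z\<in>{lo..hi}. (v' has_real_derivative v z - f z) (at z within {lo..hi})) \<and>
     v lo = A * p lo \<and> v' lo = A * p' lo \<and> v hi = B * q hi \<and> v' hi = B * q' hi"
   "\<And>A v'. v lo = A * p lo \<Longrightarrow> v' lo = A * p' lo \<Longrightarrow> BL v v'"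
   "\<And>A v'. v hi = A * q hi \<Longrightarrow> v' hi = A * q' hi \<Longrightarrow> BR v v'"
  shows "solves_bvp lo hi BL BR f v"
  using assms(1)
  apply clarify
  subgoal for A B v'
    unfolding solves_bvp_def
    apply (rule exI[of _ v'], rule exI[of _ "\<lambda>z. v z - f z"])
    using assms(2)[of A v'] assms(3)[of B v'] by auto
  done

definition gl_d :: "real \<Rightarrow> real \<Rightarrow> real \<Rightarrow> real" where
  "gl_d a b z = (if a = 0 then gl a b z else cosh (z - a))"

definition gr_d :: "real \<Rightarrow> real \<Rightarrow> real \<Rightarrow> real" where
  "gr_d a b z = (if b = 1 then - gr a b z else - cosh (b - z))"

lemma gl_gr_deriv: "(gl a b has_real_derivative gl_d a b z) (at z)"
 "(gl_d a b has_real_derivative gl a b z) (at z)"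
 "(gr a b has_real_derivative gr_d a b z) (at z)"
 "(gr_d a b has_real_derivative gr a b z) (at z)"
  unfolding gl_def[abs_def] gr_def[abs_def] gl_d_def[abs_def] gr_d_def[abs_def]
  by (auto intro!: derivative_eq_intros)

lemma gl_gr_wronskian: assumes "a < b" shows
  "coef a b * (gl_d a b z * gr a b z - gl a b z * gr_d a b z) = 1"
proof -
  have *: "sinh (b-z) * cosh (z-a) + cosh (b-z) * sinh (z-a) = sinh (b-a)"
    using sinh_add[of "b-z" "z-a"] by simp
  have ne: "exp (2*b) - exp (2*a) \<noteq> 0" using assms by simp
  have s: "coef a b * sinh (b-a) = 1" if "a \<noteq> 0" "b \<noteq> 1"
  proof -
    have "sinh (b-a) * (2 * exp (a+b)) = exp (2*b) - exp (2*a)"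
      by (simp add: sinh_field_def algebra_simps flip: exp_add) (simp add: field_simps)
    with ne show ?thesis using that unfolding coef_def by (simp add: field_simps)
  qed
  have e: "exp (z - c) * sinh (c - z) + exp (z-c) * cosh (c-z) = 1" for c
    by (simp add: sinh_field_def cosh_field_def field_simps exp_diff exp_minus)
  have e2: "exp (c - z) * cosh (z-c) + exp (c-z) * sinh (z-c) = 1" for c
    by (simp add: sinh_field_def cosh_field_def field_simps exp_diff exp_minus)
  show ?thesis
  proof (cases "a \<noteq> 0 \<and> b \<noteq> 1")
    case True
    then have "gl_d a b z * gr a b z - gl a b z * gr_d a b z = sinh (b-a)"
      using * by (simp add: gl_def gr_def gl_d_def gr_d_def algebra_simps)
    then show ?thesis using s True by simp
  next
    case False
    then show ?thesis using e[of b] e2[of a] 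
      by (auto simp: gl_def gr_def gl_d_def gr_d_def algebra_simps coef_def simp flip: exp_add)
  qed
qed

lemma parent_bc_leftI: "v a = A * gl a b a \<Longrightarrow> v' a = A * gl_d a b a \<Longrightarrow> parent_bc_left a v v'"
  by (cases "a = 0") (auto simp: parent_bc_left_def gl_d_def gl_def split: if_splits)
lemma parent_bc_rightI: "v b = A * gr a b b \<Longrightarrow> v' b = A * gr_d a b b \<Longrightarrow> parent_bc_right b v v'"
  by (cases "b = 1") (auto simp: parent_bc_right_def gr_d_def gr_def split: if_splits)

lemma Gp_greens_function:
  assumes "a < b"
  shows "greens_function a b (parent_bc_left a) (parent_bc_right b) (Gp a b)"
  unfolding greens_function_def
proof (intro allI impI)
  fix f :: "real \<Rightarrow> real" assume f: "continuous_on {a..b} f"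
  show "solves_bvp a b (parent_bc_left a) (parent_bc_right b) f (\<lambda>z. integral {a..b} (\<lambda>y. Gp a b z y * f y))"
    apply (rule solves_bvpI[where p="gl a b" and q="gr a b" and p'="gl_d a b" and q'="gr_d a b"])
      apply (rule green_core[where c="coef a b", OF assms gl_gr_deriv(1) gl_gr_deriv(2) gl_gr_deriv(3) gl_gr_deriv(4) gl_gr_wronskian[OF assms] _ f])
      apply (simp add: Gp_def)
     apply (erule (1) parent_bc_leftI)
    by (erule (1) parent_bc_rightI)
qed

end

theory Submission
  imports Defs
begin

text \<open>
  With \<open>\<gamma>\<^sup>2 = gr a b \<zeta> / gl a b \<zeta>\<close> both child kernels have the form
  \<open>K z y = c * p (min z y) * q (max z y)\<close>, where \<open>p\<close> and \<open>q\<close> solve the homogeneous equation,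
  satisfy one boundary condition each, and have the Wronskian \<open>1 / c\<close>. Positive definiteness
  follows from the Gram representation
  \<open>K z y = \<beta> * p z * p y + \<integral> \<phi> z t * \<phi> y t dt\<close> with \<open>\<phi> z t = p z / p t\<close> for \<open>z < t\<close>
  (and \<open>0\<close> otherwise) and \<open>\<beta> = c * q hi / p hi \<ge> 0\<close>, which comes from \<open>(q / p)' = - 1 / (c * p\<^sup>2)\<close>.
  As \<open>p\<close> is increasing, \<open>\<phi>\<close> takes values in \<open>[0, 1]\<close> even where \<open>p\<close> vanishes at \<open>lo\<close>, so
  Fubini applies to all integrable \<open>f\<close>. The quadratic form is zero only if \<open>\<integral> p * f\<close> over
  \<open>[lo, t]\<close> is zero for almost all \<open>t\<close>, i.e. only if \<open>f\<close> is zero almost everywhere.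
\<close>

section \<open>Fubini for quadratic forms of Gram kernels\<close>

lemma (in pair_sigma_finite) integrable_mult_fst_snd:
  fixes f :: "'a \<Rightarrow> real" and g :: "'b \<Rightarrow> real"
  assumes f: "integrable M1 f" and g: "integrable M2 g"
  shows "integrable (M1 \<Otimes>\<^sub>M M2) (\<lambda>(x, y). f x * g y)"
proof (rule Fubini_integrable)
  have [measurable]: "f \<in> borel_measurable M1" "g \<in> borel_measurable M2"
    using f g by auto
  show "(\<lambda>(x, y). f x * g y) \<in> borel_measurable (M1 \<Otimes>\<^sub>M M2)"
    by measurable
  show "integrable M1 (\<lambda>x. LINT y|M2. norm (case (x, y) of (x, y) \<Rightarrow> f x * g y))"
    using f by (simp add: abs_mult)
  show "AE x in M1. integrable M2 (\<lambda>y. case (x, y) of (x, y) \<Rightarrow> f x * g y)"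
    using g by simp
qed

text \<open>Fubini for \<open>f z * f y * \<phi> z t * \<phi> y t\<close> on the triple product:
  integrating over \<open>t\<close> first gives the quadratic form of the Gram kernel, integrating
  over \<open>(z, y)\<close> first gives a square for each \<open>t\<close>. As
  \<open>\<phi>\<close> is bounded by 1, the integrand is dominated by
  \<open>\<bar>f z * f y\<bar>\<close>, which is integrable in all three variables because
  \<open>M\<close> is finite.\<close>

lemma (in finite_measure) gram_quadratic_form:
  fixes f :: "'a \<Rightarrow> real" and \<phi> :: "'a \<Rightarrow> 'a \<Rightarrow> real"
  assumes f: "integrable M f"
    and \<phi> [measurable]: "case_prod \<phi> \<in> borel_measurable (M \<Otimes>\<^sub>M M)"
    and le1: "\<And>z t. z \<in> space M \<Longrightarrow> t \<in> space M \<Longrightarrow> \<bar>\<phi> z t\<bar> \<le> 1"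
  shows "integrable M (\<lambda>t. (LINT z|M. f z * \<phi> z t)\<^sup>2)" (is ?int)
    and "(LINT z|M. f z * (LINT y|M. (LINT t|M. \<phi> z t * \<phi> y t) * f y)) =
         (LINT t|M. (LINT z|M. f z * \<phi> z t)\<^sup>2)" (is ?eq)
proof -
  interpret P: pair_sigma_finite M M ..
  interpret T: pair_sigma_finite "M \<Otimes>\<^sub>M M" M ..
  have [measurable]: "f \<in> borel_measurable M" using f by auto
  define H where "H = (\<lambda>w t. (f (fst w) * f (snd w)) * (\<phi> (fst w) t * \<phi> (snd w) t))"
  have int3: "integrable ((M \<Otimes>\<^sub>M M) \<Otimes>\<^sub>M M) (case_prod H)"
  proof (rule Bochner_Integration.integrable_bound)
    show "integrable ((M \<Otimes>\<^sub>M M) \<Otimes>\<^sub>M M) (\<lambda>(w, t). (\<lambda>(x, y). f x * f y) w * 1)"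
      by (intro T.integrable_mult_fst_snd P.integrable_mult_fst_snd f integrable_const)
    have [measurable]: "(\<lambda>x. \<phi> (fst (fst x)) (snd x)) \<in> borel_measurable ((M \<Otimes>\<^sub>M M) \<Otimes>\<^sub>M M)"
      "(\<lambda>x. \<phi> (snd (fst x)) (snd x)) \<in> borel_measurable ((M \<Otimes>\<^sub>M M) \<Otimes>\<^sub>M M)"
      by measurable
    show "case_prod H \<in> borel_measurable ((M \<Otimes>\<^sub>M M) \<Otimes>\<^sub>M M)"
      unfolding H_def case_prod_beta by measurable
    show "AE x in (M \<Otimes>\<^sub>M M) \<Otimes>\<^sub>M M. norm (case x of (w, t) \<Rightarrow> H w t)
        \<le> norm (case x of (w, t) \<Rightarrow> (case w of (x, y) \<Rightarrow> f x * f y) * 1)"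
    proof (rule AE_I2)
      fix x assume "x \<in> space ((M \<Otimes>\<^sub>M M) \<Otimes>\<^sub>M M)"
      then obtain z y t where x: "x = ((z, y), t)" "z \<in> space M" "y \<in> space M" "t \<in> space M"
        by (auto simp: space_pair_measure)
      then have "\<bar>\<phi> z t * \<phi> y t\<bar> \<le> 1"
        using le1[of z t] le1[of y t] mult_mono[of "\<bar>\<phi> z t\<bar>" 1 "\<bar>\<phi> y t\<bar>" 1]
        by (simp add: abs_mult)
      then have "\<bar>f z * f y\<bar> * \<bar>\<phi> z t * \<phi> y t\<bar> \<le> \<bar>f z * f y\<bar>"
        by (rule mult_left_le) simp
      then show "norm (case x of (w, t) \<Rightarrow> H w t)
        \<le> norm (case x of (w, t) \<Rightarrow> (case w of (x, y) \<Rightarrow> f x * f y) * 1)"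
        by (simp add: x H_def abs_mult)
    qed
  qed
  have inner_t: "(LINT w|(M \<Otimes>\<^sub>M M). H w t) = (LINT z|M. f z * \<phi> z t)\<^sup>2" if t: "t \<in> space M" for t
  proof -
    define u where "u z = f z * \<phi> z t" for z
    have [measurable]: "(\<lambda>z. \<phi> z t) \<in> borel_measurable M"
      using t by measurable
    have "integrable M u"
    proof (rule Bochner_Integration.integrable_bound[OF f])
      show "u \<in> borel_measurable M"
        unfolding u_def by measurable
      show "AE x in M. norm (u x) \<le> norm (f x)"
        using le1[OF _ t] by (intro AE_I2) (simp add: u_def abs_mult mult_left_le)
    qed
    then have "integrable (M \<Otimes>\<^sub>M M) (\<lambda>(x, y). u x * u y)"
      by (intro P.integrable_mult_fst_snd)
    from P.integral_fst'[OF this]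
    have "(LINT w|(M \<Otimes>\<^sub>M M). (case w of (x, y) \<Rightarrow> u x * u y)) = (LINT x|M. u x)\<^sup>2"
      by (simp add: power2_eq_square)
    then show ?thesis
      by (simp add: H_def u_def case_prod_unfold mult_ac)
  qed
  have inner_w: "(LINT w|(M \<Otimes>\<^sub>M M). LINT t|M. H w t) =
      (LINT z|M. LINT y|M. f z * f y * (LINT t|M. \<phi> z t * \<phi> y t))"
    using P.integral_fst'[OF T.integrable_fst'[OF int3]] by (simp add: H_def)
  show ?int
    using T.integrable_snd[OF int3] inner_t
    by (simp cong: Bochner_Integration.integrable_cong)
  show ?eq
    using T.Fubini_integral[OF int3] inner_t inner_w
    by (simp cong: Bochner_Integration.integral_cong add: mult.assoc mult.commute[of "f _" "LINT t|M. _ t"])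
qed

section \<open>Functions with vanishing integrals over intervals\<close>

text \<open>The positive and the negative part of \<open>g\<close> are densities of two measures
  that are finite and equal on all open right half-lines. Half-lines determine such measures, and a
  measure determines its density almost everywhere.\<close>

lemma AE_lborel_eq_0_if_integral_greaterThan:
  fixes g :: "real \<Rightarrow> real"
  assumes g: "integrable lborel g"
    and zero: "\<And>x. (LINT y|lborel. indicator {x<..} y * g y) = 0"
  shows "AE x in lborel. g x = 0"
proof -
  have [measurable]: "g \<in> borel_measurable lborel" using g by auto
  let ?P = "density lborel (\<lambda>x. ennreal (g x))" and ?N = "density lborel (\<lambda>x. ennreal (- g x))"
  have int: "integrable lborel (\<lambda>y. indicator {x<..} y * g y)" for x
    using g by (intro integrable_mult_indicator[where 'b=real, simplified]) auto
  have P: "emeasure ?P {x<..} = (\<integral>\<^sup>+y. ennreal (indicator {x<..} y * g y) \<partial>lborel)" for x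
    by (subst emeasure_density) (auto intro!: nn_integral_cong split: split_indicator)
  have N: "emeasure ?N {x<..} = (\<integral>\<^sup>+y. ennreal (- (indicator {x<..} y * g y)) \<partial>lborel)" for x
    by (subst emeasure_density) (auto intro!: nn_integral_cong split: split_indicator)
  \<comment> \<open>The integral of an integrable function is the difference of two finite
    nonnegative integrals, so its vanishing equates them.\<close>
  have eq: "emeasure ?P {x<..} < \<infinity> \<and> emeasure ?P {x<..} = emeasure ?N {x<..}" for x
    using int[of x] zero[of x] unfolding P N real_lebesgue_integral_def[OF int] real_integrable_def
    by (auto simp: less_top) (metis ennreal_enn2real less_top)
  have "?P = ?N"
  proof (rule measure_eqI_lessThan)
    show "emeasure ?P {x<..} < \<infinity>" "emeasure ?P {x<..} = emeasure ?N {x<..}" for x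
      using eq[of x] by blast+
  qed simp_all
  then have "AE x in lborel. ennreal (g x) = ennreal (- g x)"
    by (intro sigma_finite_measure.density_unique[OF sigma_finite_lborel]) auto
  then show ?thesis
  proof (rule AE_mp, intro AE_I2 impI)
    \<comment> \<open>\<open>ennreal\<close> sends negative reals to 0, so one side is 0 whatever
      the sign of \<open>g x\<close>, and the equation then forces \<open>g x = 0\<close>.\<close>
    fix x assume "ennreal (g x) = ennreal (- g x)"
    then show "g x = 0"
      by (cases "g x \<ge> 0") (auto simp: ennreal_neg ennreal_eq_0_iff dest: sym)
  qed
qed

text \<open>The indefinite integral is continuous, so vanishing almost everywhere makes it vanish
  everywhere. Then \<open>f\<close> has zero integral over each half-line intersected with
  \<open>[lo, hi]\<close>, and the preceding lemma applies to a Borel version of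
  \<open>f\<close>.\<close>

lemma AE_lebesgue_on_eq_0_if_indefinite_integral:
  fixes f :: "real \<Rightarrow> real"
  assumes lt: "lo < hi" and f: "integrable (lebesgue_on {lo..hi}) f"
    and AE0: "AE t in lebesgue_on {lo..hi}. integral {lo..t} f = 0"
  shows "AE x in lebesgue_on {lo..hi}. f x = 0"
proof -
  define F where "F t = integral {lo..t} f" for t
  have fi: "f integrable_on {lo..hi}"
    using f by (rule integrable_on_lebesgue_on) simp
  have cont: "continuous_on {lo..hi} F"
    unfolding F_def[abs_def] by (rule indefinite_integral_continuous_1[OF fi])
  \<comment> \<open>The points of the open interval with \<open>F\<close> nonzero form an open set
    that is negligible, hence empty. The end points follow by continuity.\<close>
  let ?U = "{lo<..<hi} \<inter> F -` (- {0})"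
  have "open ?U"
    using cont by (intro continuous_open_preimage) (auto intro: continuous_on_subset)
  moreover have "negligible ?U"
  proof -
    have "AE t in lebesgue. t \<notin> ?U"
      using AE0 by (auto simp: AE_restrict_space_iff F_def elim!: AE_mp)
    then show ?thesis
      using AE_iff_null_sets[of ?U lebesgue] \<open>open ?U\<close> by (auto simp: negligible_iff_null_sets)
  qed
  ultimately have U: "?U = {}"
    using open_not_negligible by blast
  have F0: "F t = 0" if "t \<in> {lo..hi}" for t
  proof (rule continuous_constant_on_closure[of "{lo<..<hi}" F 0 t])
    show "continuous_on (closure {lo<..<hi}) F" "t \<in> closure {lo<..<hi}"
      using lt cont that by simp_all
    show "F x = 0" if "x \<in> {lo<..<hi}" for x
      using U that by blast
  qed
  \<comment> \<open>Here \<open>h\<close> extends \<open>f\<close> by zero to the whole line. The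
    half-line criterion is stated for \<open>lborel\<close>, so \<open>h\<close>, which is only
    Lebesgue measurable, is replaced by a Borel function \<open>g\<close> equal to it almost
    everywhere.\<close>
  define h where "h = (\<lambda>x. indicator {lo..hi} x * f x)"
  have h: "integrable lebesgue h"
    using f by (simp add: h_def integrable_restrict_space)
  then obtain g where [measurable]: "g \<in> borel_measurable lborel" and "AE x in lborel. h x = g x"
    using completion_ex_borel_measurable_real[of h lborel] by auto
  then have hg: "AE x in lebesgue. h x = g x"
    by (simp add: AE_completion_iff)
  have gm: "g \<in> borel_measurable lebesgue"
    by (rule measurable_completion) measurable
  have g: "integrable lborel g"
    using h hg gm by (subst integrable_completion[symmetric]) (auto intro: integrable_cong_AE_imp)
  have "(LINT y|lborel. indicator {x<..} y * g y) = 0" for x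
  proof -
    have "(LINT y|lborel. indicator {x<..} y * g y) = (LINT y|lebesgue. indicator {x<..} y * g y)"
      by (subst integral_completion) auto
    also have "\<dots> = (LINT y|lebesgue. indicator {x<..} y * h y)"
    proof (rule integral_cong_AE)
      have "h \<in> borel_measurable lebesgue" "indicat_real {x<..} \<in> borel_measurable lebesgue"
        using h by (auto intro: borel_measurable_indicator)
      then show "(\<lambda>y. indicator {x<..} y * g y) \<in> borel_measurable lebesgue"
        "(\<lambda>y. indicator {x<..} y * h y) \<in> borel_measurable lebesgue"
        using gm by (simp_all add: borel_measurable_times)
      show "AE y in lebesgue. indicator {x<..} y * g y = indicator {x<..} y * h y"
        using hg by eventually_elim simp
    qed
    also have "\<dots> = (LINT y|lebesgue. indicator ({lo..hi} \<inter> {x<..}) y *\<^sub>R f y)"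
      by (simp add: h_def indicator_inter_arith mult_ac)
    also have "\<dots> = integral ({lo..hi} \<inter> {x<..}) f"
    proof -
      have "integrable lebesgue (\<lambda>y. indicator {x<..} y *\<^sub>R h y)"
        using h by (intro integrable_mult_indicator) auto
      then have "set_integrable lebesgue ({lo..hi} \<inter> {x<..}) f"
        by (simp add: set_integrable_def h_def indicator_inter_arith mult_ac)
      from set_lebesgue_integral_eq_integral(2)[OF this] show ?thesis
        by (simp add: set_lebesgue_integral_def)
    qed
    also have "\<dots> = 0"
    proof -
      \<comment> \<open>In the three cases the integral is \<open>F hi\<close>,
        \<open>F hi - F x\<close>, and an integral over the empty set.\<close>
      consider "x < lo" | "lo \<le> x" "x \<le> hi" | "hi < x" by linarith
      then show ?thesis
      proof cases
        case 1
        then have "{lo..hi} \<inter> {x<..} = {lo..hi}" by auto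
        then show ?thesis using F0[of hi] lt by (simp add: F_def)
      next
        case 2
        then have "{lo..hi} \<inter> {x<..} = {x<..hi}" by auto
        moreover have "integral {x<..hi} f = integral {x..hi} f"
          by (rule integral_subset_negligible)
             (auto intro: negligible_subset[of "{x}"])
        moreover have "F x + integral {x..hi} f = F hi"
          unfolding F_def using 2 fi
          by (intro Henstock_Kurzweil_Integration.integral_combine) auto
        ultimately show ?thesis using F0[of x] F0[of hi] 2 lt by simp
      next
        case 3
        then have "{lo..hi} \<inter> {x<..} = {}" by auto
        then show ?thesis by simp
      qed
    qed
    finally show ?thesis .
  qed
  from AE_lborel_eq_0_if_integral_greaterThan[OF g this]
  have "AE x in lebesgue. g x = 0"
    by (rule AE_completion)
  then have "AE x in lebesgue. h x = 0"
    using hg by eventually_elim simp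
  then show ?thesis
    by (auto simp: AE_restrict_space_iff h_def elim!: AE_mp)
qed


section \<open>Positive definiteness of semiseparable kernels\<close>

text \<open>The numerator in the quotient rule is the Wronskian. This supplies the antiderivative of
  \<open>1 / p\<^sup>2\<close> with which the Gram integral is evaluated.\<close>

lemma has_real_derivative_inverse_square:
  fixes p q :: "real \<Rightarrow> real"
  assumes p: "(p has_real_derivative p') (at z)" and q: "(q has_real_derivative q') (at z)"
    and w: "c * (p' * q z - p z * q') = 1" and nz: "p z \<noteq> 0"
  shows "((\<lambda>z. - c * q z / p z) has_real_derivative 1 / (p z)\<^sup>2) (at z)"
proof -
  have "((\<lambda>z. - c * q z / p z) has_real_derivative
      c * (p' * q z - p z * q') / (p z)\<^sup>2) (at z)"
    using nz by (auto intro!: derivative_eq_intros p q simp: field_simps power2_eq_square)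
  then show ?thesis using w by simp
qed

text \<open>One criterion for both children: the left one is the case \<open>q hi = 0\<close>, where
  the rank-one term of the Gram representation drops out, and the right one the case
  \<open>p lo = 0\<close>. Strict positivity therefore has to come from the integral term
  alone.\<close>

lemma positive_definite_on_semiseparable:
  fixes p p' q q' :: "real \<Rightarrow> real"
  assumes lt: "lo < hi" and c: "0 < c"
    and p: "\<And>z. (p has_real_derivative p' z) (at z)"
    and q: "\<And>z. (q has_real_derivative q' z) (at z)"
    and w: "\<And>z. c * (p' z * q z - p z * q' z) = 1"
    and K: "\<And>z y. \<lbrakk>z \<in> {lo..hi}; y \<in> {lo..hi}\<rbrakk> \<Longrightarrow>
              K z y = (if y \<le> z then c * q z * p y else c * p z * q y)"
    and plo: "0 \<le> p lo" and qhi: "0 \<le> q hi"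
    and mono: "\<And>x y. \<lbrakk>x \<in> {lo..hi}; y \<in> {lo..hi}; x < y\<rbrakk> \<Longrightarrow> p x < p y"
  shows "positive_definite_on {lo..hi} K"
  unfolding positive_definite_on_def
proof (intro allI impI)
  fix f :: "real \<Rightarrow> real"
  assume fm [measurable]: "f \<in> borel_measurable (lebesgue_on {lo..hi})"
    and f2: "(\<lambda>z. (f z)\<^sup>2) integrable_on {lo..hi}"
    and nn: "\<not> negligible {z \<in> {lo..hi}. f z \<noteq> 0}"
  define M where "M = lebesgue_on {lo..hi}"
  have spM [simp]: "space M = {lo..hi}" by (simp add: M_def)
  have [measurable]: "f \<in> borel_measurable M" using fm by (simp add: M_def)
  interpret finite_measure M
    unfolding M_def by (rule finite_measure_lebesgue_on) simp
  have int_eq: "integral {lo..hi} g = (LINT z|M. g z)" if "integrable M g" for g :: "real \<Rightarrow> real"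
    using that unfolding M_def by (simp add: lebesgue_integral_eq_integral)
  have "(\<lambda>z. (f z)\<^sup>2) absolutely_integrable_on {lo..hi}"
    using f2 by (subst absolutely_integrable_on_iff_nonneg) auto
  then have "integrable M (\<lambda>z. (f z)\<^sup>2)"
    by (simp add: M_def integrable_restrict_space set_integrable_def)
  then have f: "integrable M f"
    by (rule square_integrable_imp_integrable[rotated]) measurable
  have bM: "g \<in> borel_measurable M" if "g \<in> borel_measurable borel" for g :: "real \<Rightarrow> real"
    unfolding M_def by (intro measurable_restrict_space1 measurable_completion) (use that in simp)
  have [measurable]: "p \<in> borel_measurable M" "q \<in> borel_measurable M"
    using p q by (auto intro!: bM borel_measurable_continuous_onI continuous_at_imp_continuous_on DERIV_isCont)
  have idM: "(\<lambda>x. x) \<in> borel_measurable M" by (rule bM) simp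
  have [measurable]: "fst \<in> borel_measurable (M \<Otimes>\<^sub>M M)" "snd \<in> borel_measurable (M \<Otimes>\<^sub>M M)"
    using measurable_compose[OF measurable_fst[of M M] idM] measurable_compose[OF measurable_snd[of M M] idM]
    by simp_all
  have p0: "0 \<le> p z" if "z \<in> {lo..hi}" for z
    using plo mono[of lo z] that by (cases "z = lo") auto
  have pp: "0 < p z" if "z \<in> {lo<..hi}" for z
    using plo mono[of lo z] that by auto
  \<comment> \<open>With the strict inequality \<open>z < t\<close>, the quotient is used only for
    \<open>t > lo\<close>, where \<open>p t > 0\<close>.\<close>
  define \<phi> where "\<phi> z t = (if z < t then p z / p t else 0)" for z t
  have \<phi>m [measurable]: "case_prod \<phi> \<in> borel_measurable (M \<Otimes>\<^sub>M M)"
  proof -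
    have "(\<lambda>x. if fst x < snd x then p (fst x) / p (snd x) else 0) \<in> borel_measurable (M \<Otimes>\<^sub>M M)"
      by (intro measurable_If borel_measurable_divide borel_measurable_const borel_measurable_pred_less
            measurable_compose[OF measurable_fst] measurable_compose[OF measurable_snd]) measurable
    then show ?thesis by (simp add: \<phi>_def case_prod_beta')
  qed
  have \<phi>1: "\<bar>\<phi> z t\<bar> \<le> 1" if "z \<in> space M" "t \<in> space M" for z t
    using that p0[of z] mono[of z t] by (auto simp: \<phi>_def)
  note gram = gram_quadratic_form[OF f \<phi>m \<phi>1]
  \<comment> \<open>The end point term at \<open>hi\<close> that the fundamental theorem of calculus
    leaves when \<open>1 / p\<^sup>2\<close> is integrated.\<close>
  define \<beta> where "\<beta> = c * q hi / p hi"
  have \<beta>: "0 \<le> \<beta>"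
    using c qhi pp[of hi] lt by (simp add: \<beta>_def)
  have Keq: "K z y = \<beta> * p z * p y + (LINT t|M. \<phi> z t * \<phi> y t)"
    if z: "z \<in> {lo..hi}" and y: "y \<in> {lo..hi}" for z y
  proof (cases "p z = 0 \<or> p y = 0")
    \<comment> \<open>Since \<open>p\<close> is strictly increasing with
      \<open>p lo \<ge> 0\<close>, its only possible zero is \<open>lo\<close>, and there both sides
      vanish.\<close>
    case True
    then have "(\<lambda>t. \<phi> z t * \<phi> y t) = (\<lambda>t. 0)"
      by (auto simp: \<phi>_def)
    moreover have "K z y = 0"
      using True K[OF z y] mono[OF z y] mono[OF y z] p0[OF z] p0[OF y]
      by (cases z y rule: linorder_cases) auto
    ultimately show ?thesis using True by auto
  next
    case False
    \<comment> \<open>The product \<open>\<phi> z t * \<phi> y t\<close> is zero for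
      \<open>t \<le> m\<close> and equals \<open>p z * p y / (p t)\<^sup>2\<close> for
      \<open>t > m\<close>, so only \<open>[m, hi]\<close> contributes. There \<open>p\<close> is
      positive even if \<open>m = lo\<close>, because then \<open>z = y = lo\<close> and
      \<open>p z\<close> is nonzero in this case.\<close>
    define m where "m = max z y"
    have m: "m \<in> {lo..hi}" using z y by (auto simp: m_def)
    have pm: "p x > 0" if "x \<in> {m..hi}" for x
    proof (cases "x = lo")
      case True
      then have "x = z" using that z y by (auto simp: m_def)
      then show ?thesis using False p0[OF z] by auto
    next
      case False
      then show ?thesis using that m by (intro pp) auto
    qed
    have "((\<lambda>t. 1 / (p t)\<^sup>2) has_integral - c * q hi / p hi - (- c * q m / p m)) {m..hi}"
    proof (rule fundamental_theorem_of_calculus)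
      show "m \<le> hi" using m by simp
      fix x assume "x \<in> {m..hi}"
      then have "p x \<noteq> 0" using pm[of x] by simp
      from has_real_derivative_inverse_square[of p "p' x" x q "q' x" c, OF p q w this]
      show "((\<lambda>z. - c * q z / p z) has_vector_derivative 1 / (p x)\<^sup>2) (at x within {m..hi})"
        by (simp add: has_real_derivative_iff_has_vector_derivative has_vector_derivative_at_within)
    qed
    from has_integral_mult_right[OF this, of "p z * p y"]
    have "((\<lambda>t. p z * p y * (1 / (p t)\<^sup>2)) has_integral p z * p y * (c * q m / p m - \<beta>)) {m..hi}"
      by (simp add: \<beta>_def)
    \<comment> \<open>The two integrands differ at most at \<open>t = m\<close>, where the strict
      inequality in \<open>\<phi>\<close> gives 0.\<close>
    then have "((\<lambda>t. \<phi> z t * \<phi> y t) has_integral p z * p y * (c * q m / p m - \<beta>)) {m..hi}"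
      by (rule has_integral_spike[of "{m}", rotated 2])
         (auto simp: \<phi>_def m_def power2_eq_square)
    moreover have "((\<lambda>t. \<phi> z t * \<phi> y t) has_integral 0) {lo..m}"
      by (rule has_integral_is_0) (auto simp: \<phi>_def m_def)
    ultimately have "((\<lambda>t. \<phi> z t * \<phi> y t) has_integral p z * p y * (c * q m / p m - \<beta>)) {lo..hi}"
      using has_integral_combine[of lo m hi "\<lambda>t. \<phi> z t * \<phi> y t" 0] m by simp
    moreover have "integrable M (\<lambda>t. \<phi> z t * \<phi> y t)"
    proof (rule integrable_const_bound[where B = 1])
      show "AE t in M. norm (\<phi> z t * \<phi> y t) \<le> 1"
        using \<phi>1[of z] \<phi>1[of y] z y by (intro AE_I2) (auto simp: abs_mult intro!: mult_le_one)
      have [measurable]: "(\<lambda>t. \<phi> z t) \<in> borel_measurable M" "(\<lambda>t. \<phi> y t) \<in> borel_measurable M"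
        using z y measurable_compose[OF measurable_Pair1' \<phi>m] by simp_all
      show "(\<lambda>t. \<phi> z t * \<phi> y t) \<in> borel_measurable M" by measurable
    qed
    ultimately have "(LINT t|M. \<phi> z t * \<phi> y t) = p z * p y * (c * q m / p m - \<beta>)"
      using int_eq integral_unique by metis
    moreover have "K z y = p z * p y * (c * q m / p m)"
      using False K[OF z y] by (auto simp: m_def max_def)
    ultimately show ?thesis by (simp add: algebra_simps)
  qed
  define g where "g z = f z * p z" for z
  have intb: "integrable M (\<lambda>z. f z * h z)"
    if [measurable]: "h \<in> borel_measurable M" and B: "\<And>z. z \<in> {lo..hi} \<Longrightarrow> \<bar>h z\<bar> \<le> B" for h and B :: real
  proof (rule Bochner_Integration.integrable_bound)
    show "integrable M (\<lambda>z. B * f z)" using f by simp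
    show "AE z in M. norm (f z * h z) \<le> norm (B * f z)"
    proof (rule AE_I2)
      fix z assume "z \<in> space M"
      then have "\<bar>f z\<bar> * \<bar>h z\<bar> \<le> \<bar>f z\<bar> * \<bar>B\<bar>" using B[of z] by (intro mult_left_mono) auto
      then show "norm (f z * h z) \<le> norm (B * f z)" by (simp add: abs_mult mult.commute)
    qed
  qed measurable
  have g: "integrable M g"
    unfolding g_def
  proof (rule intb)
    show "\<bar>p z\<bar> \<le> p hi" if "z \<in> {lo..hi}" for z
      using p0[OF that] mono[of z hi] that lt by (cases "z = hi") auto
  qed measurable
  define L where "L z y = (LINT t|M. \<phi> z t * \<phi> y t)" for z y
  have L1: "\<bar>L z y\<bar> \<le> measure M (space M)" if "z \<in> {lo..hi}" "y \<in> {lo..hi}" for z y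
  proof -
    have "\<bar>\<phi> z t * \<phi> y t\<bar> \<le> 1" if "t \<in> space M" for t
      using \<phi>1[of z t] \<phi>1[of y t] \<open>z \<in> _\<close> \<open>y \<in> _\<close> that by (auto simp: abs_mult intro!: mult_le_one)
    then show ?thesis
      unfolding L_def
      using integral_mono'[of M "\<lambda>t. 1" "\<lambda>t. \<bar>\<phi> z t * \<phi> y t\<bar>"]
      by (intro order_trans[OF integral_abs_bound]) auto
  qed
  have Lm [measurable]: "case_prod L \<in> borel_measurable (M \<Otimes>\<^sub>M M)"
    unfolding L_def by measurable
  have Lint: "integrable M (\<lambda>y. f y * L z y)" if "z \<in> {lo..hi}" for z
  proof (rule intb[OF _ L1[OF that]])
    show "L z \<in> borel_measurable M"
      using that measurable_compose[OF measurable_Pair1' Lm] by simp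
  qed
  have inner: "integral {lo..hi} (\<lambda>y. K z y * f y) =
      \<beta> * (LINT y|M. g y) * p z + (LINT y|M. L z y * f y)" if z: "z \<in> {lo..hi}" for z
  proof -
    have "integral {lo..hi} (\<lambda>y. K z y * f y) =
        integral {lo..hi} (\<lambda>y. \<beta> * p z * g y + f y * L z y)"
      by (intro Henstock_Kurzweil_Integration.integral_cong)
         (simp add: Keq[OF z] g_def L_def algebra_simps)
    also have "\<dots> = (LINT y|M. \<beta> * p z * g y + f y * L z y)"
      using g Lint[OF z] by (intro int_eq) auto
    also have "\<dots> = \<beta> * (LINT y|M. g y) * p z + (LINT y|M. L z y * f y)"
      using g Lint[OF z] by (simp add: mult_ac)
    finally show ?thesis .
  qed
  define \<Phi> where "\<Phi> t = (LINT z|M. f z * \<phi> z t)" for t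
  have outer: "integrable M (\<lambda>z. f z * (LINT y|M. L z y * f y))"
  proof (rule intb)
    show "\<bar>LINT y|M. L z y * f y\<bar> \<le> (LINT y|M. measure M (space M) * \<bar>f y\<bar>)"
      if "z \<in> {lo..hi}" for z
      using L1[OF that] f
      by (intro order_trans[OF integral_abs_bound] integral_mono') (auto simp: abs_mult mult_right_mono)
  qed measurable
  have Q: "integral {lo..hi} (\<lambda>z. f z * integral {lo..hi} (\<lambda>y. K z y * f y)) =
      \<beta> * (LINT y|M. g y)\<^sup>2 + (LINT t|M. (\<Phi> t)\<^sup>2)"
  proof -
    have "integral {lo..hi} (\<lambda>z. f z * integral {lo..hi} (\<lambda>y. K z y * f y)) =
        integral {lo..hi} (\<lambda>z. \<beta> * (LINT y|M. g y) * g z + f z * (LINT y|M. L z y * f y))"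
      by (intro Henstock_Kurzweil_Integration.integral_cong)
         (simp only: inner, simp add: g_def algebra_simps)
    also have "\<dots> = (LINT z|M. \<beta> * (LINT y|M. g y) * g z + f z * (LINT y|M. L z y * f y))"
      using g outer by (intro int_eq) auto
    also have "\<dots> = \<beta> * (LINT y|M. g y)\<^sup>2 + (LINT z|M. f z * (LINT y|M. L z y * f y))"
      using g outer by (simp add: power2_eq_square)
    finally show ?thesis
      using gram(2) by (simp add: L_def \<Phi>_def)
  qed
  \<comment> \<open>For \<open>t > lo\<close>, \<open>\<Phi> t\<close> is the integral of
    \<open>g = f * p\<close> over \<open>[lo, t]\<close> divided by \<open>p t\<close>. If the
    integral of \<open>\<Phi>\<^sup>2\<close> were zero, the indefinite integral of \<open>g\<close>
    would vanish almost everywhere, hence so would \<open>g\<close>, and so would \<open>f\<close>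
    because \<open>p\<close> is positive off \<open>lo\<close>.\<close>
  have "(LINT t|M. (\<Phi> t)\<^sup>2) \<noteq> 0"
  proof
    assume "(LINT t|M. (\<Phi> t)\<^sup>2) = 0"
    then have "AE t in M. (\<Phi> t)\<^sup>2 = 0"
      using gram(1) by (subst (asm) integral_nonneg_eq_0_iff_AE) (auto simp: \<Phi>_def)
    moreover have "AE t in M. t \<noteq> lo"
      unfolding M_def by (subst AE_restrict_space_iff) (auto intro: AE_completion AE_lborel_singleton AE_mp)
    moreover have "AE t in M. t \<in> space M" by (rule AE_space)
    ultimately have "AE t in M. integral {lo..t} g = 0"
    proof eventually_elim
      case (elim t)
      then have pt: "p t > 0" and t: "t \<in> {lo..hi}" using pp[of t] by auto
      have \<phi>t: "(\<lambda>z. \<phi> z t) \<in> borel_measurable M"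
        using t measurable_compose[OF measurable_Pair2' \<phi>m] by simp
      have "integral {lo..t} g = integral {lo..t} (\<lambda>z. p t * (f z * (p z / p t)))"
        using pt by (intro Henstock_Kurzweil_Integration.integral_cong) (simp add: g_def)
      also have "\<dots> = p t * integral {lo..t} (\<lambda>z. f z * (p z / p t))"
        by (rule Henstock_Kurzweil_Integration.integral_mult_right)
      also have "integral {lo..t} (\<lambda>z. f z * (p z / p t)) = integral {lo..t} (\<lambda>z. f z * \<phi> z t)"
        by (rule integral_spike[of "{t}"]) (auto simp: \<phi>_def)
      also have "\<dots> = integral {lo..hi} (\<lambda>z. f z * \<phi> z t)"
        using t by (intro integral_spike_set) (auto simp: \<phi>_def intro: negligible_subset[of "{}"])
      also have "\<dots> = \<Phi> t"
        unfolding \<Phi>_def using t \<phi>1 by (intro int_eq intb[OF \<phi>t, of 1]) auto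
      finally show ?case using elim by simp
    qed
    then have "AE x in M. g x = 0"
      using AE_lebesgue_on_eq_0_if_indefinite_integral[OF lt] g unfolding M_def by blast
    then have "AE x in lebesgue. x \<in> {lo..hi} \<longrightarrow> g x = 0"
      unfolding M_def by (subst (asm) AE_restrict_space_iff) auto
    moreover have "AE x in lebesgue. x \<noteq> lo"
      by (intro AE_completion AE_lborel_singleton)
    ultimately have "AE x in lebesgue. x \<notin> {z \<in> {lo..hi}. f z \<noteq> 0}"
    proof eventually_elim
      case (elim x)
      then show ?case using pp[of x] by (auto simp: g_def)
    qed
    then obtain N where "N \<in> null_sets lebesgue"
      and N: "\<And>x. x \<in> space lebesgue - N \<Longrightarrow> x \<notin> {z \<in> {lo..hi}. f z \<noteq> 0}"
      by (rule AE_E3) blast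
    then have "negligible N" by (simp add: negligible_iff_null_sets)
    then have "negligible {z \<in> {lo..hi}. f z \<noteq> 0}"
      by (rule negligible_subset) (use N in auto)
    then show False using nn by simp
  qed
  moreover have "(LINT t|M. (\<Phi> t)\<^sup>2) \<ge> 0" by simp
  moreover have "\<beta> * (LINT y|M. g y)\<^sup>2 \<ge> 0" using \<beta> by simp
  ultimately show "integral {lo..hi} (\<lambda>z. f z * integral {lo..hi} (\<lambda>y. K z y * f y)) > 0"
    unfolding Q by linarith
qed

section \<open>Signs and monotonicity of \<open>gl\<close> and \<open>gr\<close>\<close>

lemma coef_pos: "a < b \<Longrightarrow> 0 < coef a b"
  by (simp add: coef_def)

lemma gl_pos: "\<lbrakk>0 \<le> a; a < z\<rbrakk> \<Longrightarrow> 0 < gl a b z"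
  by (simp add: gl_def)

lemma gr_pos: "\<lbrakk>z < b; b \<le> 1\<rbrakk> \<Longrightarrow> 0 < gr a b z"
  by (simp add: gr_def)

lemma gl_left_nonneg: "0 \<le> gl a b a"
  by (simp add: gl_def)

lemma gr_right_nonneg: "0 \<le> gr a b b"
  by (simp add: gr_def)

lemma gl_strict_mono: "x < y \<Longrightarrow> gl a b x < gl a b y"
  by (simp add: gl_def)

lemma gr_strict_antimono: "x < y \<Longrightarrow> gr a b y < gr a b x"
  by (simp add: gr_def)

section \<open>Green's functions from pairs of homogeneous solutions\<close>

text \<open>By \<open>green_core\<close>, the value and the derivative of the potential at
  \<open>lo\<close> are a common multiple of those of \<open>p\<close>, and at \<open>hi\<close> of
  those of \<open>q\<close>. So each boundary condition has to be checked on such multiples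
  only.\<close>

lemma greens_functionI:
  assumes "lo < hi"
    and "\<And>z. (p has_real_derivative p' z) (at z)" "\<And>z. (p' has_real_derivative p z) (at z)"
    and "\<And>z. (q has_real_derivative q' z) (at z)" "\<And>z. (q' has_real_derivative q z) (at z)"
    and "\<And>z. c * (p' z * q z - p z * q' z) = 1"
    and "\<And>z y. \<lbrakk>z \<in> {lo..hi}; y \<in> {lo..hi}\<rbrakk> \<Longrightarrow>
           K z y = (if y \<le> z then c * q z * p y else c * p z * q y)"
    and "\<And>v v' A. v lo = A * p lo \<Longrightarrow> v' lo = A * p' lo \<Longrightarrow> BL v v'"
    and "\<And>v v' A. v hi = A * q hi \<Longrightarrow> v' hi = A * q' hi \<Longrightarrow> BR v v'"
  shows "greens_function lo hi BL BR K"
  unfolding greens_function_def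
proof (intro allI impI)
  fix f :: "real \<Rightarrow> real"
  assume "continuous_on {lo..hi} f"
  from green_core[where K = K, OF assms(1-7) this] assms(8,9)
  show "solves_bvp lo hi BL BR f (\<lambda>z. integral {lo..hi} (\<lambda>y. K z y * f y))"
    by (rule solves_bvpI)
qed

section \<open>Uniqueness and modification of solutions\<close>

text \<open>
  Energy argument: \<open>(w w')' = w\<^sup>2 + w'\<^sup>2 \<ge> 0\<close>, while the boundary conditions make
  \<open>w w'\<close> nonnegative at \<open>lo\<close> and nonpositive at \<open>hi\<close>; hence \<open>w w' = 0\<close> and \<open>w\<^sup>2\<close> is constant.
\<close>

lemma homogeneous_bvp_zero:
  fixes w w' :: "real \<Rightarrow> real"
  assumes lt: "lo < hi"
    and w: "\<And>z. z \<in> {lo..hi} \<Longrightarrow> (w has_real_derivative w' z) (at z within {lo..hi})"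
    and w': "\<And>z. z \<in> {lo..hi} \<Longrightarrow> (w' has_real_derivative w z) (at z within {lo..hi})"
    and bc: "0 \<le> w lo * w' lo" "w hi * w' hi \<le> 0" and zero: "w lo = 0 \<or> w hi = 0"
    and z: "z \<in> {lo..hi}"
  shows "w z = 0"
proof -
  have d: "((\<lambda>x. w x * w' x) has_real_derivative (w x)\<^sup>2 + (w' x)\<^sup>2) (at x within {lo..hi})"
    if "x \<in> {lo..hi}" for x
    using w[OF that] w'[OF that] by (auto intro!: derivative_eq_intros simp: power2_eq_square)
  have mono: "w x * w' x \<le> w y * w' y" if "lo \<le> x" "x \<le> y" "y \<le> hi" for x y
    using \<open>x \<le> y\<close>
  proof (rule DERIV_nonneg_imp_increasing_open)
    show "continuous_on {x..y} (\<lambda>x. w x * w' x)"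
      by (rule continuous_on_subset[OF DERIV_continuous_on[OF d]]) (use that in auto)
    fix t assume "x < t" "t < y"
    then show "\<exists>k. ((\<lambda>x. w x * w' x) has_real_derivative k) (at t) \<and> 0 \<le> k"
      using d[of t] that by (intro exI[of _ "(w t)\<^sup>2 + (w' t)\<^sup>2"]) (simp add: at_within_Icc_at)
  qed
  have ww': "w x * w' x = 0" if "x \<in> {lo..hi}" for x
    using mono[of lo x] mono[of x hi] bc that by (intro antisym) auto
  have "((\<lambda>x. (w x)\<^sup>2) has_real_derivative 0) (at x within {lo..hi})" if "x \<in> {lo..hi}" for x
    using w[OF that] ww'[OF that] by (auto intro!: derivative_eq_intros)
  then obtain k where "\<And>x. x \<in> {lo..hi} \<Longrightarrow> (w x)\<^sup>2 = k"
    using has_field_derivative_zero_constant[of "{lo..hi}" "\<lambda>x. (w x)\<^sup>2"] by auto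
  moreover from this zero lt have "k = 0"
    by (metis atLeastAtMost_iff less_imp_le order_refl zero_power2)
  ultimately show ?thesis using z by simp
qed

text \<open>The energy argument is applied to the difference of the solutions. Stating the
  conditions as signs of (difference of values) times (difference of derivatives) treats Dirichlet
  and Robin conditions alike; the interface condition provides the end point where the difference
  vanishes.\<close>

lemma solves_bvp_unique:
  assumes lt: "lo < hi"
    and u: "solves_bvp lo hi BL BR f u" and v: "solves_bvp lo hi BL BR f v"
    and BL: "\<And>u u' v v'. BL u u' \<Longrightarrow> BL v v' \<Longrightarrow> 0 \<le> (u lo - v lo) * (u' lo - v' lo)"
    and BR: "\<And>u u' v v'. BR u u' \<Longrightarrow> BR v v' \<Longrightarrow> (u hi - v hi) * (u' hi - v' hi) \<le> 0"
    and zero: "u lo = v lo \<or> u hi = v hi"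
    and z: "z \<in> {lo..hi}"
  shows "u z = v z"
proof -
  obtain u' u'' where u': "\<And>z. z \<in> {lo..hi} \<Longrightarrow> (u has_real_derivative u' z) (at z within {lo..hi})"
      "\<And>z. z \<in> {lo..hi} \<Longrightarrow> (u' has_real_derivative u'' z) (at z within {lo..hi})"
      "\<And>z. z \<in> {lo..hi} \<Longrightarrow> u z - u'' z = f z" "BL u u'" "BR u u'"
    using u unfolding solves_bvp_def by blast
  obtain v' v'' where v': "\<And>z. z \<in> {lo..hi} \<Longrightarrow> (v has_real_derivative v' z) (at z within {lo..hi})"
      "\<And>z. z \<in> {lo..hi} \<Longrightarrow> (v' has_real_derivative v'' z) (at z within {lo..hi})"
      "\<And>z. z \<in> {lo..hi} \<Longrightarrow> v z - v'' z = f z" "BL v v'" "BR v v'"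
    using v unfolding solves_bvp_def by blast
  have "u z - v z = 0"
  proof (rule homogeneous_bvp_zero[OF lt _ _ BL BR _ z])
    fix x assume x: "x \<in> {lo..hi}"
    show "((\<lambda>z. u z - v z) has_real_derivative u' x - v' x) (at x within {lo..hi})"
      using u'(1)[OF x] v'(1)[OF x] by (rule DERIV_diff)
    have "u'' x - v'' x = u x - v x" using u'(3)[OF x] v'(3)[OF x] by simp
    then show "((\<lambda>z. u' z - v' z) has_real_derivative u x - v x) (at x within {lo..hi})"
      using DERIV_diff[OF u'(2)[OF x] v'(2)[OF x]] by simp
  qed (use zero u' v' in auto)
  then show ?thesis by simp
qed

text \<open>A multiple of a homogeneous solution leaves the right-hand side unchanged. Agreement is
  required on \<open>[lo, hi]\<close> only, because the single layer potential is a multiple of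
  \<open>gl\<close> to the left of \<zeta> and of \<open>gr\<close> to the right.\<close>

lemma solves_bvp_add_homogeneous:
  assumes "solves_bvp a b BL BR f u" and sub: "{lo..hi} \<subseteq> {a..b}"
    and p: "\<And>z. (p has_real_derivative p' z) (at z)" "\<And>z. (p' has_real_derivative p z) (at z)"
    and v: "\<And>z. z \<in> {lo..hi} \<Longrightarrow> v z = u z - s * p z"
    and BL: "\<And>u'. BL u u' \<Longrightarrow> BR u u' \<Longrightarrow> BL' v (\<lambda>z. u' z - s * p' z)"
    and BR: "\<And>u'. BL u u' \<Longrightarrow> BR u u' \<Longrightarrow> BR' v (\<lambda>z. u' z - s * p' z)"
  shows "solves_bvp lo hi BL' BR' f v"
proof -
  obtain u' u'' where u: "\<And>z. z \<in> {a..b} \<Longrightarrow> (u has_real_derivative u' z) (at z within {a..b})"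
      "\<And>z. z \<in> {a..b} \<Longrightarrow> (u' has_real_derivative u'' z) (at z within {a..b})"
      "\<And>z. z \<in> {a..b} \<Longrightarrow> u z - u'' z = f z" "BL u u'" "BR u u'"
    using assms(1) unfolding solves_bvp_def by blast
  have d: "(u has_real_derivative u' z) (at z within {lo..hi})"
      "(u' has_real_derivative u'' z) (at z within {lo..hi})" "u z - u'' z = f z"
    if "z \<in> {lo..hi}" for z
    using u(1-3)[of z] that sub by (auto intro: has_field_derivative_subset)
  have "(v has_real_derivative u' z - s * p' z) (at z within {lo..hi})" if "z \<in> {lo..hi}" for z
  proof (rule has_field_derivative_transform_within[OF _ zero_less_one that])
    show "((\<lambda>z. u z - s * p z) has_real_derivative u' z - s * p' z) (at z within {lo..hi})"
      by (intro DERIV_diff DERIV_cmult d[OF that] has_field_derivative_at_within[OF p(1)])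
  qed (simp add: v)
  moreover have "((\<lambda>z. u' z - s * p' z) has_real_derivative u'' z - s * p z) (at z within {lo..hi})"
    if "z \<in> {lo..hi}" for z
    by (intro DERIV_diff DERIV_cmult d[OF that] has_field_derivative_at_within[OF p(2)])
  ultimately show ?thesis
    unfolding solves_bvp_def using BL BR u(4,5) d(3)
    by (intro exI[of _ "\<lambda>z. u' z - s * p' z"] exI[of _ "\<lambda>z. u'' z - s * p z"]) (auto simp: v)
qed

section \<open>Splitting the parent problem at \<zeta>\<close>

theorem theorem4p2:
  fixes a b \<zeta> :: real
  assumes "0 \<le> a" and "a < \<zeta>" and "\<zeta> < b" and "b \<le> 1"
  shows "\<exists>\<gamma>::real. \<gamma> \<noteq> 0 \<and>
    greens_function a \<zeta> (parent_bc_left a) (zero_bc \<zeta>) (Gl a b \<gamma>) \<and>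
    positive_definite_on {a..\<zeta>} (Gl a b \<gamma>) \<and>
    greens_function \<zeta> b (zero_bc \<zeta>) (parent_bc_right b) (Gr a b \<gamma>) \<and>
    positive_definite_on {\<zeta>..b} (Gr a b \<gamma>) \<and>
    (\<forall>f u. continuous_on {a..b} f \<longrightarrow>
       solves_bvp a b (parent_bc_left a) (parent_bc_right b) f u \<longrightarrow>
       (\<exists>\<sigma>. solves_bvp a \<zeta> (parent_bc_left a) (zero_bc \<zeta>) f (\<lambda>z. u z - \<sigma> * Gp a b z \<zeta>) \<and>
            solves_bvp \<zeta> b (zero_bc \<zeta>) (parent_bc_right b) f (\<lambda>z. u z - \<sigma> * Gp a b z \<zeta>) \<and>
            (\<forall>u\<^sub>1. solves_bvp a \<zeta> (parent_bc_left a) (zero_bc \<zeta>) f u\<^sub>1 \<longrightarrow>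
               (\<forall>z\<in>{a..\<zeta>}. u\<^sub>1 z = u z - \<sigma> * Gp a b z \<zeta>)) \<and>
            (\<forall>u\<^sub>2. solves_bvp \<zeta> b (zero_bc \<zeta>) (parent_bc_right b) f u\<^sub>2 \<longrightarrow>
               (\<forall>z\<in>{\<zeta>..b}. u\<^sub>2 z = u z - \<sigma> * Gp a b z \<zeta>))))"
proof -
  have ab: "a < b" using assms by simp
  define c where "c = coef a b"
  define l where "l = gl a b"
  define l' where "l' = gl_d a b"
  define r where "r = gr a b"
  define r' where "r' = gr_d a b"
  have c: "0 < c" using coef_pos[OF ab] by (simp add: c_def)
  have l0: "0 < l \<zeta>" and r0: "0 < r \<zeta>"
    using assms by (simp_all add: l_def r_def gl_pos gr_pos)
  have l: "(l has_real_derivative l' z) (at z)" "(l' has_real_derivative l z) (at z)"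
    and r: "(r has_real_derivative r' z) (at z)" "(r' has_real_derivative r z) (at z)" for z
    unfolding l_def l'_def r_def r'_def by (rule gl_gr_deriv)+
  have W: "c * (l' z * r z - l z * r' z) = 1" for z
    unfolding c_def l_def l'_def r_def r'_def by (rule gl_gr_wronskian[OF ab])
  have bc_left: "parent_bc_left a v v'" if "v a = A * l a" "v' a = A * l' a" for v v' A
    using parent_bc_leftI that unfolding l_def l'_def .
  have bc_right: "parent_bc_right b v v'" if "v b = A * r b" "v' b = A * r' b" for v v' A
    using parent_bc_rightI that unfolding r_def r'_def .
  have G: "Gp a b z y = (if y \<le> z then c * r z * l y else c * l z * r y)" for z y
    by (simp add: Gp_def c_def l_def r_def)
  \<comment> \<open>This ratio makes both \<open>r - k * l\<close> and \<open>l - 1 / k * r\<close>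
    vanish at \<zeta>, so one number serves both children. It is positive, hence a square.\<close>
  define k where "k = r \<zeta> / l \<zeta>"
  define \<gamma> where "\<gamma> = sqrt k"
  have k: "0 < k" using l0 r0 by (simp add: k_def)
  have \<gamma>: "\<gamma> \<noteq> 0" "\<gamma>\<^sup>2 = k" using k by (simp_all add: \<gamma>_def)
  \<comment> \<open>\<open>Gl\<close> has the form of \<open>Gp\<close> with \<open>r\<close>
    replaced by \<open>q\<close>, and \<open>Gr\<close> has it with \<open>l\<close> replaced by
    \<open>p\<close>.\<close>
  define q where "q z = r z - k * l z" for z
  define q' where "q' z = r' z - k * l' z" for z
  define p where "p z = l z - 1 / k * r z" for z
  define p' where "p' z = l' z - 1 / k * r' z" for z
  have q: "(q has_real_derivative q' z) (at z)" "(q' has_real_derivative q z) (at z)"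
    and p: "(p has_real_derivative p' z) (at z)" "(p' has_real_derivative p z) (at z)" for z
    unfolding q_def[abs_def] q'_def[abs_def] p_def[abs_def] p'_def[abs_def]
    by (intro DERIV_diff DERIV_cmult l r)+
  \<comment> \<open>Subtracting a multiple of the partner solution does not change the Wronskian, so
    the factor \<open>c\<close> still normalizes it to 1.\<close>
  have Wq: "c * (l' z * q z - l z * q' z) = 1" and Wp: "c * (p' z * r z - p z * r' z) = 1" for z
    using W[of z] by (simp_all add: q_def q'_def p_def p'_def algebra_simps)
  have q\<zeta>: "q \<zeta> = 0" and p\<zeta>: "p \<zeta> = 0"
    using l0 r0 by (simp_all add: q_def p_def k_def)
  have Gl: "Gl a b \<gamma> z y = (if y \<le> z then c * q z * l y else c * l z * q y)" for z y
    by (simp add: Gl_def G \<gamma> q_def algebra_simps flip: c_def l_def)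
  have Gr: "Gr a b \<gamma> z y = (if y \<le> z then c * r z * p y else c * p z * r y)" for z y
    by (simp add: Gr_def G \<gamma> p_def algebra_simps flip: c_def r_def)
  have l_mono: "l x < l y" and p_mono: "p x < p y" if "x < y" for x y
    using k gl_strict_mono[OF that, of a b] gr_strict_antimono[OF that, of a b]
    by (simp_all add: p_def l_def r_def add_strict_mono divide_strict_right_mono diff_strict_mono)
  show ?thesis
  proof (intro exI conjI allI impI)
    show "greens_function a \<zeta> (parent_bc_left a) (zero_bc \<zeta>) (Gl a b \<gamma>)"
      by (rule greens_functionI[OF assms(2) l q Wq Gl bc_left]) (auto simp: zero_bc_def q\<zeta>)
    show "positive_definite_on {a..\<zeta>} (Gl a b \<gamma>)"
      by (rule positive_definite_on_semiseparable[OF assms(2) c l(1) q(1) Wq Gl])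
         (auto simp: q\<zeta> l_mono, simp add: l_def gl_left_nonneg)
    show "greens_function \<zeta> b (zero_bc \<zeta>) (parent_bc_right b) (Gr a b \<gamma>)"
      by (rule greens_functionI[OF assms(3) p r Wp Gr _ bc_right]) (auto simp: zero_bc_def p\<zeta>)
    show "positive_definite_on {\<zeta>..b} (Gr a b \<gamma>)"
      by (rule positive_definite_on_semiseparable[OF assms(3) c p(1) r(1) Wp Gr])
         (auto simp: p\<zeta> p_mono, simp add: r_def gr_right_nonneg)
    fix f u :: "real \<Rightarrow> real"
    assume u: "solves_bvp a b (parent_bc_left a) (parent_bc_right b) f u"
    \<comment> \<open>The strength of the layer is chosen to cancel \<open>u\<close> at \<zeta>; the
      divisor is \<open>c * r \<zeta> * l \<zeta> > 0\<close>.\<close>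
    define \<sigma> where "\<sigma> = u \<zeta> / Gp a b \<zeta> \<zeta>"
    define v where "v = (\<lambda>z. u z - \<sigma> * Gp a b z \<zeta>)"
    have v\<zeta>: "v \<zeta> = 0"
      using c l0 r0 by (simp add: v_def \<sigma>_def G)
    have bc0: "parent_bc_left a l l'" "parent_bc_right b r r'"
      by (auto intro: bc_left[of _ 1] bc_right[of _ 1])
    \<comment> \<open>On each side of \<zeta> the layer is a homogeneous solution that satisfies the
      outer boundary condition of that side. At \<zeta> itself the two branches of \<open>Gp\<close>
      agree.\<close>
    have vl: "v z = u z - (\<sigma> * c * r \<zeta>) * l z" if "z \<in> {a..\<zeta>}" for z
      using that by (cases "z = \<zeta>") (auto simp: v_def G)
    have vr: "v z = u z - (\<sigma> * c * l \<zeta>) * r z" if "z \<in> {\<zeta>..b}" for z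
      using that by (auto simp: v_def G)
    have left: "solves_bvp a \<zeta> (parent_bc_left a) (zero_bc \<zeta>) f v"
    proof (rule solves_bvp_add_homogeneous[OF u _ l vl])
      fix u' assume "parent_bc_left a u u'"
      then show "parent_bc_left a v (\<lambda>z. u' z - (\<sigma> * c * r \<zeta>) * l' z)"
        using vl[of a] assms bc0(1) by (auto simp: parent_bc_left_def split: if_splits)
    qed (use assms v\<zeta> in \<open>auto simp: zero_bc_def\<close>)
    have right: "solves_bvp \<zeta> b (zero_bc \<zeta>) (parent_bc_right b) f v"
    proof (rule solves_bvp_add_homogeneous[OF u _ r vr])
      fix u' assume "parent_bc_right b u u'"
      then show "parent_bc_right b v (\<lambda>z. u' z - (\<sigma> * c * l \<zeta>) * r' z)"
        using vr[of b] assms bc0(2) by (auto simp: parent_bc_right_def algebra_simps split: if_splits)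
    qed (use assms v\<zeta> in \<open>auto simp: zero_bc_def\<close>)
    have zero: "w \<zeta> = v \<zeta>" if "solves_bvp lo hi (zero_bc \<zeta>) BR f w \<or> solves_bvp lo hi BL (zero_bc \<zeta>) f w"
      for lo hi BL BR w
      using that v\<zeta> by (auto simp: solves_bvp_def zero_bc_def)
    \<comment> \<open>Under the Robin condition at 0 the product is a square; under a Dirichlet
      condition its first factor is zero. At \<open>b\<close> the Robin condition gives the negative
      of a square.\<close>
    have BL: "0 \<le> (u a - v a) * (u' a - v' a)" if "parent_bc_left a u u'" "parent_bc_left a v v'" for u u' v v'
      using that by (auto simp: parent_bc_left_def split: if_splits)
    have BR: "(u b - v b) * (u' b - v' b) \<le> 0" if "parent_bc_right b u u'" "parent_bc_right b v v'" for u u' v v'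
    proof (cases "b = 1")
      case True
      then have "(u b - v b) * (u' b - v' b) = - (u b - v b)\<^sup>2"
        using that by (simp add: parent_bc_right_def power2_eq_square algebra_simps)
      then show ?thesis by simp
    qed (use that in \<open>simp add: parent_bc_right_def\<close>)
    have uleft: "w z = v z" if "solves_bvp a \<zeta> (parent_bc_left a) (zero_bc \<zeta>) f w" "z \<in> {a..\<zeta>}" for w z
    proof (rule solves_bvp_unique[where lo = a and hi = \<zeta> and u = w and v = v])
      show "a < \<zeta>" "z \<in> {a..\<zeta>}" by (fact assms that)+
      show "w a = v a \<or> w \<zeta> = v \<zeta>" using zero that(1) by blast
    qed (fact that left BL | simp add: zero_bc_def)+
    have uright: "w z = v z" if "solves_bvp \<zeta> b (zero_bc \<zeta>) (parent_bc_right b) f w" "z \<in> {\<zeta>..b}" for w z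
    proof (rule solves_bvp_unique[where lo = \<zeta> and hi = b and u = w and v = v])
      show "\<zeta> < b" "z \<in> {\<zeta>..b}" by (fact assms that)+
      show "w \<zeta> = v \<zeta> \<or> w b = v b" using zero that(1) by blast
    qed (fact that right BR | simp add: zero_bc_def)+
    show "solves_bvp a \<zeta> (parent_bc_left a) (zero_bc \<zeta>) f (\<lambda>z. u z - \<sigma> * Gp a b z \<zeta>)"
      "solves_bvp \<zeta> b (zero_bc \<zeta>) (parent_bc_right b) f (\<lambda>z. u z - \<sigma> * Gp a b z \<zeta>)"
      using left right by (simp_all add: v_def)
    show "\<forall>z\<in>{a..\<zeta>}. w z = u z - \<sigma> * Gp a b z \<zeta>"
      if "solves_bvp a \<zeta> (parent_bc_left a) (zero_bc \<zeta>) f w" for w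
      using uleft[OF that] by (simp add: v_def)
    show "\<forall>z\<in>{\<zeta>..b}. w z = u z - \<sigma> * Gp a b z \<zeta>"
      if "solves_bvp \<zeta> b (zero_bc \<zeta>) (parent_bc_right b) f w" for w
      using uright[OF that] by (simp add: v_def)
  qed (rule \<gamma>)
qed

end
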